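(* Let $p\ge 3$ be a prime, let $\mathbb F$ be a field of characteristic $p$, and let $\lambda\in\mathbb F^p$ with $\lambda\ne 0$. Then $$\dim H^2_*(\mathfrak m_0^\lambda(p))=\frac{3p-3}{2},$$ and the cohomology classes of $$\{(0,\overline e^1),\dots,(0,\overline e^p),(\phi_5,\tilde\phi_5),(\phi_7,\tilde\phi_7),\dots,(\phi_p,\tilde\phi_p)\}$$ form a basis, where for odd $k$ with $5\le k\le p$, $\phi_k=\sum_{i=2}^{\lfloor k/2\rfloor}(-1)^ie^{i,k-i}$. In particular, $H^2_*(\mathfrak m_0^\lambda(3))$ (the case $p=3$) has a basis consisting of the cohomology classes of the cocycles $\{(0,\overline e^1),(0,\overline e^2),(0,\overline e^3)\}$.
   Context: Let $\mathbb F$ be a field of characteristic $p>0$. $\mathfrak m_0(p)$ is the Lie algebra over $\mathbb F$ with basis $e_1,\dots,e_p$ and brackets $[e_1,e_i]=-[e_i,e_1]=e_{i+1}$ for $1<i<p$, all other brackets of basis elements being $0$. For $\lambda=(\lambda_1,\dots,\lambda_p)\in\mathbb F^p$, $\mathfrak m_0^\lambda(p)$ denotes $\mathfrak m_0(p)$ with the restricted structure $\left(\sum_k\alpha_ke_k\right)^{[p]}=\left(\sum_k\alpha_k^p\lambda_k\right)e_p$. Write $\mathfrak g=\mathfrak m_0^\lambda(p)$. Ordinary cochains (trivial coefficients $\mathbb F$): $C^n(\mathfrak g)=(\wedge^n\mathfrak g)^*$; $\{e^k\}$ is the basis of $\mathfrak g^*$ dual to $\{e_k\}$, and $\{e^{i,j}:1\le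 i<j\le p\}$ is the basis of $C^2(\mathfrak g)$ dual to $\{e_i\wedge e_j\}$. Differentials: $d^1(\psi)(g,h)=\psi([g,h])$ and $d^2(\phi)(g,h,f)=\phi([g,h]\wedge f)-\phi([g,f]\wedge h)+\phi([h,f]\wedge g)$. Restricted cochains: $C^1_*(\mathfrak g)=\mathfrak g^*$. For $\phi\in C^2(\mathfrak g)$, a map $\omega:\mathfrak g\to\mathbb F$ has the $*$-property with respect to $\phi$ if $\omega(\alpha g)=\alpha^p\omega(g)$ for $\alpha\in\mathbb F$, and for all $g,h\in\mathfrak g$ $$\omega(g+h)=\omega(g)+\omega(h)+\sum\frac{1}{\#(g)}\,\phi([g_1,g_2,\dots,g_{p-1}]\wedge g_p),$$ the sum being over all formal sequences $(g_1,\dots,g_p)$ with each $g_i$ equal to $g$ or $h$, $g_1=g$, $g_2=h$; $\#(g)$ is the number of positions filled with $g$, and $[g_1,\dots,g_j]=[[\cdots[[g_1,g_2],g_3],\dots],g_j]$. Given $\phi$, the values of such $\omega$ on the basis $e_1,\dots,e_p$ can be prescribed arbitrarily and determine $\omega$. $C^2_*(\mathfrak g)$ is the vector space of pairs $(\phi,\omega)$ with $\phi\in C^2(\mathfrak g)$ and $\omega$ having the $*$-property with respect to $\phi$. Put $\overline e^k\left(\sum_i\alpha_ie_i\right)=\alpha_k^p$, and for $\phi\in C^2(\mathfrak g)$ let $\tilde\phi$ be the map with the $*$-property with respect to $\phi$ that vanishes on $e_1,\dots,e_p$. Restricted differentials: $d^1_*(\psi)=(d^1\psi,\operatorname{ind}^1(\psi))$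 with $\operatorname{ind}^1(\psi)(g)=\psi(g^{[p]})$, and $d^2_*(\phi,\omega)=(d^2\phi,\operatorname{ind}^2(\phi,\omega))$, where $\operatorname{ind}^2(\phi,\omega):\mathfrak g\times\mathfrak g\to\mathbb F$ is $\operatorname{ind}^2(\phi,\omega)(g,h)=\phi(g\wedge h^{[p]})$. Thus $\ker d^2_*$ consists of the pairs with $d^2\phi=0$ and $\operatorname{ind}^2(\phi,\omega)=0$, and $H^2_*(\mathfrak g)=\ker d^2_*/\operatorname{im}d^1_*$. For $p=3$ the list $\phi_5,\dots,\phi_p$ is empty. *)

theory Defs
  imports "HOL-Algebra.AbelCoset" "Jordan_Normal_Form.VS_Connect"
begin

section \<open>The restricted Lie algebra\<close>

text \<open>
  The underlying space of the algebra over a field \<open>'a\<close> of characteristic \<open>p > 0\<close>: a vector is its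
  family of coordinates with respect to \<open>e\<^sub>1, \<dots>, e\<^sub>p\<close>, where \<open>p = CHAR('a)\<close>, extended by \<open>0\<close>.
\<close>

typedef (overloaded) 'a m0 = "{f :: nat \<Rightarrow> 'a::field. \<forall>k. k \<notin> {1..CHAR('a)} \<longrightarrow> f k = 0}"
  morphisms coord Abs_m0
  by (rule exI[of _ "\<lambda>_. 0"]) simp

setup_lifting type_definition_m0

lemma m0_eqI: "(\<And>k. coord x k = coord y k) \<Longrightarrow> x = y"
  by (metis coord_inject ext)

instantiation m0 :: (field) ab_group_add
begin

lift_definition zero_m0 :: "'a m0" is "\<lambda>_. 0" by simp
lift_definition plus_m0 :: "'a m0 \<Rightarrow> 'a m0 \<Rightarrow> 'a m0" is "\<lambda>f g k. f k + g k" by simp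
lift_definition minus_m0 :: "'a m0 \<Rightarrow> 'a m0 \<Rightarrow> 'a m0" is "\<lambda>f g k. f k - g k" by simp
lift_definition uminus_m0 :: "'a m0 \<Rightarrow> 'a m0" is "\<lambda>f k. - f k" by simp

instance
  by standard (transfer, simp add: fun_eq_iff algebra_simps)+

end

lift_definition scale_m0 :: "'a::field \<Rightarrow> 'a m0 \<Rightarrow> 'a m0" is "\<lambda>c f k. c * f k" by simp

text \<open>The basis vector \<open>e\<^sub>k\<close>; it is \<open>0\<close> for indices outside \<open>1, \<dots>, p\<close>.\<close>

lift_definition e_vec :: "nat \<Rightarrow> 'a::field m0"
  is "\<lambda>k j. if j = k \<and> k \<in> {1..CHAR('a)} then 1 else 0"
  by auto

lemma vector_space_m0: "vector_space (scale_m0 :: 'a::field \<Rightarrow> 'a m0 \<Rightarrow> 'a m0)"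
  by standard (transfer, simp add: fun_eq_iff algebra_simps)+

definition basis_bracket :: "nat \<Rightarrow> nat \<Rightarrow> 'a::field m0" where
  "basis_bracket i j =
     (if i = 1 \<and> 1 < j \<and> j < CHAR('a) then e_vec (j + 1)
      else if j = 1 \<and> 1 < i \<and> i < CHAR('a) then - e_vec (i + 1)
      else 0)"

definition bracket :: "'a::field m0 \<Rightarrow> 'a m0 \<Rightarrow> 'a m0" where
  "bracket x y =
     (\<Sum>i=1..CHAR('a). \<Sum>j=1..CHAR('a). scale_m0 (coord x i * coord y j) (basis_bracket i j))"

definition p_map :: "(nat \<Rightarrow> 'a::field) \<Rightarrow> 'a m0 \<Rightarrow> 'a m0" where
  "p_map lam x = scale_m0 (\<Sum>k=1..CHAR('a). coord x k ^ CHAR('a) * lam k) (e_vec CHAR('a))"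


section \<open>Cochains and differentials\<close>

text \<open>
  The space \<open>(\<Lambda>\<^sup>2 g)\<^sup>*\<close> is identified with the space of alternating bilinear forms on \<open>g\<close>,
  \<open>\<phi> (x \<and> y)\<close> being written \<open>\<phi> x y\<close>.
\<close>

definition C1 :: "('a::field m0 \<Rightarrow> 'a) set" where
  "C1 = {\<psi>. Vector_Spaces.linear scale_m0 (*) \<psi>}"

definition C2 :: "('a::field m0 \<Rightarrow> 'a m0 \<Rightarrow> 'a) set" where
  "C2 = {\<phi>. (\<forall>x. Vector_Spaces.linear scale_m0 (*) (\<lambda>y. \<phi> x y)) \<and>
             (\<forall>y. Vector_Spaces.linear scale_m0 (*) (\<lambda>x. \<phi> x y)) \<and>
             (\<forall>x. \<phi> x x = 0)}"

definition e_dual2 :: "nat \<Rightarrow> nat \<Rightarrow> 'a::field m0 \<Rightarrow> 'a m0 \<Rightarrow> 'a" where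
  "e_dual2 i j x y = coord x i * coord y j - coord x j * coord y i"

definition d1 :: "('a::field m0 \<Rightarrow> 'a) \<Rightarrow> 'a m0 \<Rightarrow> 'a m0 \<Rightarrow> 'a" where
  "d1 \<psi> g h = \<psi> (bracket g h)"

definition d2 :: "('a::field m0 \<Rightarrow> 'a m0 \<Rightarrow> 'a) \<Rightarrow> 'a m0 \<Rightarrow> 'a m0 \<Rightarrow> 'a m0 \<Rightarrow> 'a" where
  "d2 \<phi> g h f = \<phi> (bracket g h) f - \<phi> (bracket g f) h + \<phi> (bracket h f) g"

text \<open>The left-normed bracket of a nonempty list.\<close>

definition brackets :: "'a::field m0 list \<Rightarrow> 'a m0" where
  "brackets gs = foldl bracket (hd gs) (tl gs)"

text \<open>
  A formal sequence in the two symbols \<open>g\<close>, \<open>h\<close> is a list of Booleans, \<open>True\<close> standing for \<open>g\<close>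
  and \<open>False\<close> for \<open>h\<close>; so sequences stay distinct when the vectors \<open>g\<close> and \<open>h\<close> coincide.
\<close>

definition formal_sequences :: "nat \<Rightarrow> bool list set" where
  "formal_sequences p = {s. length s = p \<and> s ! 0 = True \<and> s ! 1 = False}"

definition star_correction :: "('a::field m0 \<Rightarrow> 'a m0 \<Rightarrow> 'a) \<Rightarrow> 'a m0 \<Rightarrow> 'a m0 \<Rightarrow> 'a" where
  "star_correction \<phi> g h =
     (\<Sum>s\<in>formal_sequences CHAR('a).
        let gs = map (\<lambda>b. if b then g else h) s
        in 1 / of_nat (count_list s True) * \<phi> (brackets (butlast gs)) (last gs))"

definition star_property :: "('a::field m0 \<Rightarrow> 'a m0 \<Rightarrow> 'a) \<Rightarrow> ('a m0 \<Rightarrow> 'a) \<Rightarrow> bool" where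
  "star_property \<phi> \<omega> \<longleftrightarrow>
     (\<forall>\<alpha> g. \<omega> (scale_m0 \<alpha> g) = \<alpha> ^ CHAR('a) * \<omega> g) \<and>
     (\<forall>g h. \<omega> (g + h) = \<omega> g + \<omega> h + star_correction \<phi> g h)"

type_synonym 'a cochain2 = "('a m0 \<Rightarrow> 'a m0 \<Rightarrow> 'a) \<times> ('a m0 \<Rightarrow> 'a)"

definition C2_star :: "('a::field, 'a cochain2) module" where
  "C2_star = \<lparr>
     carrier = {(\<phi>, \<omega>). \<phi> \<in> C2 \<and> star_property \<phi> \<omega>},
     mult = undefined,
     one = undefined,
     zero = (\<lambda>_ _. 0, \<lambda>_. 0),
     add = (\<lambda>(\<phi>, \<omega>) (\<phi>', \<omega>'). (\<lambda>x y. \<phi> x y + \<phi>' x y, \<lambda>x. \<omega> x + \<omega>' x)),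
     smult = (\<lambda>c (\<phi>, \<omega>). (\<lambda>x y. c * \<phi> x y, \<lambda>x. c * \<omega> x))\<rparr>"

definition ind1 :: "(nat \<Rightarrow> 'a::field) \<Rightarrow> ('a m0 \<Rightarrow> 'a) \<Rightarrow> 'a m0 \<Rightarrow> 'a" where
  "ind1 lam \<psi> g = \<psi> (p_map lam g)"

definition ind2 :: "(nat \<Rightarrow> 'a::field) \<Rightarrow> 'a cochain2 \<Rightarrow> 'a m0 \<Rightarrow> 'a m0 \<Rightarrow> 'a" where
  "ind2 lam = (\<lambda>(\<phi>, \<omega>) g h. \<phi> g (p_map lam h))"

definition d1_star :: "(nat \<Rightarrow> 'a::field) \<Rightarrow> ('a m0 \<Rightarrow> 'a) \<Rightarrow> 'a cochain2" where
  "d1_star lam \<psi> = (d1 \<psi>, ind1 lam \<psi>)"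

definition d2_star :: "(nat \<Rightarrow> 'a::field) \<Rightarrow> 'a cochain2 \<Rightarrow>
    ('a m0 \<Rightarrow> 'a m0 \<Rightarrow> 'a m0 \<Rightarrow> 'a) \<times> ('a m0 \<Rightarrow> 'a m0 \<Rightarrow> 'a)" where
  "d2_star lam z = (d2 (fst z), ind2 lam z)"


section \<open>Restricted cohomology\<close>

definition Z2_star :: "(nat \<Rightarrow> 'a::field) \<Rightarrow> 'a cochain2 set" where
  "Z2_star lam = {z \<in> carrier C2_star. d2_star lam z = (\<lambda>_ _ _. 0, \<lambda>_ _. 0)}"

definition B2_star :: "(nat \<Rightarrow> 'a::field) \<Rightarrow> 'a cochain2 set" where
  "B2_star lam = d1_star lam ` C1"

text \<open>
  The quotient of a module by a submodule \<open>N\<close>. Scalar multiplication takes the coset of \<open>x\<close> to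
  the coset of \<open>c x\<close>; the union collects one and the same coset for all representatives.
\<close>

definition quotient_module ::
    "('a, 'b, 'm) module_scheme \<Rightarrow> 'b set \<Rightarrow> ('a, 'b set) module" where
  "quotient_module M N = \<lparr>
     carrier = a_rcosets\<^bsub>M\<^esub> N,
     mult = undefined,
     one = undefined,
     zero = N,
     add = set_add M,
     smult = (\<lambda>c X. \<Union>x\<in>X. N +>\<^bsub>M\<^esub> (c \<odot>\<^bsub>M\<^esub> x))\<rparr>"

definition H2_star :: "(nat \<Rightarrow> 'a::field) \<Rightarrow> ('a, 'a cochain2 set) module" where
  "H2_star lam = quotient_module (C2_star\<lparr>carrier := Z2_star lam\<rparr>) (B2_star lam)"

definition cohomology_class :: "(nat \<Rightarrow> 'a::field) \<Rightarrow> 'a cochain2 \<Rightarrow> 'a cochain2 set" where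
  "cohomology_class lam z = B2_star lam +>\<^bsub>C2_star\<^esub> z"

definition e_bar :: "nat \<Rightarrow> 'a::field m0 \<Rightarrow> 'a" where
  "e_bar k x = coord x k ^ CHAR('a)"

definition tilde :: "('a::field m0 \<Rightarrow> 'a m0 \<Rightarrow> 'a) \<Rightarrow> 'a m0 \<Rightarrow> 'a" where
  "tilde \<phi> = (THE \<omega>. star_property \<phi> \<omega> \<and> (\<forall>k\<in>{1..CHAR('a)}. \<omega> (e_vec k) = 0))"

definition phi :: "nat \<Rightarrow> 'a::field m0 \<Rightarrow> 'a m0 \<Rightarrow> 'a" where
  "phi k = (\<lambda>x y. \<Sum>i=2..k div 2. (-1) ^ i * e_dual2 i (k - i) x y)"

end

theory Submission
  imports Defs
begin

text \<open>
  As \<open>\<lambda> \<noteq> 0\<close>, the condition \<open>ind2 = 0\<close> forces \<open>e\<^sub>p\<close> into the radical of \<open>\<phi>\<close> for every cocycle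
  \<open>(\<phi>, \<omega>)\<close>; then the correction term vanishes and \<open>\<omega>\<close> is \<open>p\<close>-semilinear, so given by its values
  on the basis. Closedness says \<open>\<phi> (e\<^sub>i\<^sub>+\<^sub>1, e\<^sub>j) = - \<phi> (e\<^sub>i, e\<^sub>j\<^sub>+\<^sub>1)\<close> for \<open>i, j \<ge> 2\<close>, whence the part of
  \<open>\<phi>\<close> on \<open>e\<^sub>2, \<dots>, e\<^sub>p\<close> is determined by the numbers \<open>\<phi> (e\<^sub>2, e\<^sub>k\<^sub>-\<^sub>2)\<close>, of which only those with
  \<open>k\<close> odd and \<open>5 \<le> k \<le> p\<close> can be nonzero. The remaining values \<open>\<phi> (e\<^sub>1, e\<^sub>j)\<close> are removed by a
  coboundary. Hence the functionals \<open>\<omega> (e\<^sub>k) - \<lambda>\<^sub>k \<phi> (e\<^sub>1, e\<^sub>p\<^sub>-\<^sub>1)\<close> and \<open>\<phi> (e\<^sub>2, e\<^sub>k\<^sub>-\<^sub>2)\<close> on cocycles cut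
  out exactly the coboundaries, and they are dual to the proposed basis.
\<close>

section \<open>Quotients by the common kernel of a dual family\<close>

text \<open>Pure linear algebra: functionals \<open>f i\<close> and vectors \<open>b i\<close> dual
  to them make the quotient by the common kernel a coordinate space with the classes of the
  \<open>b i\<close> as basis. For the cohomology it remains to exhibit such a family on the
  cocycles and to identify its common kernel with the coboundaries.\<close>

locale dual_family =
  Module.module "class_ring :: 'a ring" M for M :: "('a::field, 'b, 'm) module_scheme" +
  fixes I :: "'i set" and f :: "'i \<Rightarrow> 'b \<Rightarrow> 'a" and b :: "'i \<Rightarrow> 'b"
  assumes finite_I: "finite I"
    and f_add: "\<lbrakk>i \<in> I; x \<in> carrier M; y \<in> carrier M\<rbrakk> \<Longrightarrow> f i (x \<oplus>\<^bsub>M\<^esub> y) = f i x + f i y"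
    and f_smult: "\<lbrakk>i \<in> I; x \<in> carrier M\<rbrakk> \<Longrightarrow> f i (c \<odot>\<^bsub>M\<^esub> x) = c * f i x"
    and b_closed: "i \<in> I \<Longrightarrow> b i \<in> carrier M"
    and f_b: "\<lbrakk>i \<in> I; j \<in> I\<rbrakk> \<Longrightarrow> f i (b j) = (if i = j then 1 else 0)"
begin

text \<open>The cosets of the common kernel \<open>fibre (\<lambda>_. 0)\<close> are the fibres of the coordinate map, so the
  quotient is the coordinate space.\<close>

definition fibre :: "('i \<Rightarrow> 'a) \<Rightarrow> 'b set" where
  "fibre c = {x \<in> carrier M. \<forall>i\<in>I. f i x = c i}"

abbreviation "Quot \<equiv> quotient_module M (fibre (\<lambda>_. 0))"

lemma fibre_cong: "(\<And>i. i \<in> I \<Longrightarrow> c i = d i) \<Longrightarrow> fibre c = fibre d"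
  by (auto simp: fibre_def)

lemma f_zero: "i \<in> I \<Longrightarrow> f i \<zero>\<^bsub>M\<^esub> = 0"
  using f_smult[of i "\<zero>\<^bsub>M\<^esub>" 0] smult_r_null[of "0::'a"] by auto

lemma minus_add_cancel: "\<lbrakk>x \<in> carrier M; y \<in> carrier M\<rbrakk> \<Longrightarrow> y = (y \<ominus>\<^bsub>M\<^esub> x) \<oplus>\<^bsub>M\<^esub> x"
  by (simp add: a_minus_def M.a_assoc M.l_neg)

lemma f_minus: "\<lbrakk>i \<in> I; x \<in> carrier M; y \<in> carrier M\<rbrakk> \<Longrightarrow> f i (x \<ominus>\<^bsub>M\<^esub> y) = f i x - f i y"
  using f_add[of i "x \<ominus>\<^bsub>M\<^esub> y" y] minus_add_cancel[of y x] by simp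

text \<open>Duality makes the combination of the \<open>b j\<close> with coefficients
  \<open>c j\<close> a point of the fibre; it is built up one index at a time.\<close>

lemma fibre_nonempty: "\<exists>x. x \<in> fibre c"
proof -
  have "\<exists>x\<in>carrier M. \<forall>i\<in>I. f i x = (if i \<in> J then c i else 0)" if "J \<subseteq> I" for J
    using finite_subset[OF that finite_I] that
  proof (induction J rule: finite_induct)
    case empty
    show ?case using f_zero M.zero_closed by auto
  next
    case (insert j J)
    then obtain x where x: "x \<in> carrier M" "\<And>i. i \<in> I \<Longrightarrow> f i x = (if i \<in> J then c i else 0)"
      by auto
    have j: "j \<in> I" "b j \<in> carrier M" using insert b_closed by auto
    then have "c j \<odot>\<^bsub>M\<^esub> b j \<in> carrier M" by (simp add: smult_closed)
    then show ?case
      using x j insert(2)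
      by (intro bexI[of _ "x \<oplus>\<^bsub>M\<^esub> c j \<odot>\<^bsub>M\<^esub> b j"]) (auto simp: f_add f_smult f_b)
  qed
  from this[of I] show ?thesis by (auto simp: fibre_def)
qed

lemma fibre_eq_iff: "fibre c = fibre d \<longleftrightarrow> (\<forall>i\<in>I. c i = d i)"
proof
  assume *: "fibre c = fibre d"
  obtain x where "x \<in> fibre c" using fibre_nonempty by blast
  moreover from this have "x \<in> fibre d" using * by simp
  ultimately show "\<forall>i\<in>I. c i = d i" by (auto simp: fibre_def)
qed (auto simp: fibre_def)

lemma coset_eq_fibre:
  assumes "x \<in> carrier M"
  shows "fibre (\<lambda>_. 0) +>\<^bsub>M\<^esub> x = fibre (\<lambda>i. f i x)"
proof (intro equalityI subsetI)
  fix y assume "y \<in> fibre (\<lambda>i. f i x)"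
  then have "y \<ominus>\<^bsub>M\<^esub> x \<in> fibre (\<lambda>_. 0)" "y = (y \<ominus>\<^bsub>M\<^esub> x) \<oplus>\<^bsub>M\<^esub> x"
    using assms by (auto simp: fibre_def f_minus intro: minus_add_cancel)
  then show "y \<in> fibre (\<lambda>_. 0) +>\<^bsub>M\<^esub> x" unfolding a_r_coset_def' by blast
qed (use assms in \<open>auto simp: fibre_def a_r_coset_def' f_add\<close>)

lemma carrier_quot: "carrier Quot = range fibre"
proof -
  have "fibre c \<in> (\<lambda>x. fibre (\<lambda>i. f i x)) ` carrier M" for c
  proof -
    obtain x where "x \<in> fibre c" using fibre_nonempty by blast
    then show ?thesis
      by (intro image_eqI[of _ _ x]) (auto simp: fibre_def)
  qed
  then have "(\<lambda>x. fibre (\<lambda>i. f i x)) ` carrier M = range fibre" by auto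
  moreover have "carrier Quot = (\<lambda>x. fibre (\<lambda>_. 0) +>\<^bsub>M\<^esub> x) ` carrier M"
    by (auto simp: quotient_module_def A_RCOSETS_def')
  ultimately show ?thesis using coset_eq_fibre by simp
qed

lemma zero_quot: "\<zero>\<^bsub>Quot\<^esub> = fibre (\<lambda>_. 0)"
  by (simp add: quotient_module_def)

lemma add_quot: "fibre c \<oplus>\<^bsub>Quot\<^esub> fibre d = fibre (\<lambda>i. c i + d i)"
proof -
  have "fibre c <+>\<^bsub>M\<^esub> fibre d = fibre (\<lambda>i. c i + d i)"
  proof (intro equalityI subsetI)
    fix y assume y: "y \<in> fibre (\<lambda>i. c i + d i)"
    obtain x where x: "x \<in> fibre d" using fibre_nonempty by blast
    have "y \<ominus>\<^bsub>M\<^esub> x \<in> fibre c" "y = (y \<ominus>\<^bsub>M\<^esub> x) \<oplus>\<^bsub>M\<^esub> x"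
      using x y by (auto simp: fibre_def f_minus intro: minus_add_cancel)
    then show "y \<in> fibre c <+>\<^bsub>M\<^esub> fibre d" using x unfolding set_add_def' by blast
  qed (auto simp: fibre_def set_add_def' f_add)
  then show ?thesis by (simp add: quotient_module_def)
qed

text \<open>All representatives give the same coset, and since the fibre is nonempty the union in
  \<open>quotient_module\<close> is that coset.\<close>

lemma smult_quot: "k \<odot>\<^bsub>Quot\<^esub> fibre c = fibre (\<lambda>i. k * c i)"
proof -
  have "fibre (\<lambda>_. 0) +>\<^bsub>M\<^esub> (k \<odot>\<^bsub>M\<^esub> x) = fibre (\<lambda>i. k * c i)" if "x \<in> fibre c" for x
    using that by (subst coset_eq_fibre) (auto simp: fibre_def f_smult intro!: smult_closed)
  then show ?thesis
    using fibre_nonempty[of c] by (auto simp: quotient_module_def)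
qed

lemma vectorspace_quot: "vectorspace class_ring Quot"
proof -
  have "abelian_group Quot"
  proof (rule abelian_groupI)
    fix x assume "x \<in> carrier Quot"
    then obtain c where c: "x = fibre c" unfolding carrier_quot by blast
    show "\<exists>y\<in>carrier Quot. y \<oplus>\<^bsub>Quot\<^esub> x = \<zero>\<^bsub>Quot\<^esub>"
      unfolding c carrier_quot
      by (rule bexI[of _ "fibre (\<lambda>i. - c i)"]) (auto simp: add_quot zero_quot)
  qed (auto simp: carrier_quot zero_quot add_quot algebra_simps)
  then have "Module.module class_ring Quot"
    using class_cring.is_cring
    by (intro moduleI) (auto simp: carrier_quot smult_quot add_quot algebra_simps)
  then show ?thesis by (intro vectorspace.intro class_field)
qed

definition unit_coset :: "'i \<Rightarrow> 'b set" where
  "unit_coset i = fibre (\<lambda>j. if i = j then 1 else 0)"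

lemma coset_b: "j \<in> I \<Longrightarrow> fibre (\<lambda>_. 0) +>\<^bsub>M\<^esub> b j = unit_coset j"
  unfolding unit_coset_def by (subst coset_eq_fibre) (auto simp: b_closed f_b intro!: fibre_cong)

lemma inj_on_unit_coset: "inj_on unit_coset I"
  by (rule inj_onI) (fastforce simp: unit_coset_def fibre_eq_iff split: if_splits)

sublocale quot: vectorspace class_ring Quot
  by (rule vectorspace_quot)

text \<open>\<open>lincomb\<close> takes coefficients indexed by vectors, so the sum is pulled back
  to \<open>I\<close> along the injective map \<open>unit_coset\<close>.\<close>

lemma lincomb_unit_coset: "quot.lincomb a (unit_coset ` I) = fibre (\<lambda>i. a (unit_coset i))"
proof -
  have cl: "a (unit_coset i) \<odot>\<^bsub>Quot\<^esub> unit_coset i \<in> carrier Quot" for i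
    by (simp add: unit_coset_def smult_quot carrier_quot)
  have "finsum Quot (\<lambda>i. a (unit_coset i) \<odot>\<^bsub>Quot\<^esub> unit_coset i) J
      = fibre (\<lambda>i. if i \<in> J then a (unit_coset i) else 0)" if "J \<subseteq> I" for J
    using finite_subset[OF that finite_I]
  proof (induction J rule: finite_induct)
    case empty
    show ?case by (simp add: zero_quot)
  next
    case (insert j J)
    then have "finsum Quot (\<lambda>i. a (unit_coset i) \<odot>\<^bsub>Quot\<^esub> unit_coset i) (insert j J)
      = (a (unit_coset j) \<odot>\<^bsub>Quot\<^esub> unit_coset j) \<oplus>\<^bsub>Quot\<^esub>
          fibre (\<lambda>i. if i \<in> J then a (unit_coset i) else 0)"
      using cl by (subst quot.finsum_insert) auto
    also have "\<dots> = fibre (\<lambda>i. if i \<in> insert j J then a (unit_coset i) else 0)"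
      using insert(2)
      by (subst (2) unit_coset_def, subst smult_quot, subst add_quot) (auto intro!: fibre_cong)
    finally show ?case .
  qed
  note this[OF subset_refl]
  also have "fibre (\<lambda>i. if i \<in> I then a (unit_coset i) else 0) = fibre (\<lambda>i. a (unit_coset i))"
    by (rule fibre_cong) simp
  finally have "finsum Quot (\<lambda>i. a (unit_coset i) \<odot>\<^bsub>Quot\<^esub> unit_coset i) I
    = fibre (\<lambda>i. a (unit_coset i))" .
  then show ?thesis
    unfolding quot.lincomb_def
    using inj_on_unit_coset cl by (subst quot.finsum_reindex) auto
qed

lemma basis_quot: "quot.basis ((\<lambda>i. fibre (\<lambda>_. 0) +>\<^bsub>M\<^esub> b i) ` I)"
proof -
  have U: "unit_coset ` I \<subseteq> carrier Quot" "finite (unit_coset ` I)"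
    using finite_I by (auto simp: unit_coset_def carrier_quot)
  have "quot.lin_indpt (unit_coset ` I)"
    using U by (intro quot.finite_lin_indpt2) (auto simp: lincomb_unit_coset zero_quot fibre_eq_iff)
  moreover have "quot.span (unit_coset ` I) = carrier Quot"
  proof -
    have "\<exists>a. fibre c = fibre (\<lambda>i. a (unit_coset i))" for c
      using inj_on_unit_coset
      by (intro exI[of _ "\<lambda>u. c (inv_into I unit_coset u)"]) (auto intro!: fibre_cong)
    then show ?thesis
      by (subst quot.finite_span[OF U(2,1)]) (auto simp: lincomb_unit_coset carrier_quot)
  qed
  ultimately have "quot.basis (unit_coset ` I)" using U by (simp add: quot.basis_def)
  then show ?thesis using coset_b by simp
qed

lemma dim_quot: "quot.dim = card I"
proof -
  have "(\<lambda>i. fibre (\<lambda>_. 0) +>\<^bsub>M\<^esub> b i) ` I = unit_coset ` I" using coset_b by simp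
  then show ?thesis
    using quot.dim_basis[OF _ basis_quot] finite_I card_image[OF inj_on_unit_coset] by simp
qed

end

section \<open>Coordinates and brackets\<close>

lemma coord_add [simp]: "coord (x + y) k = coord x k + coord y k"
  by transfer simp

lemma coord_minus [simp]: "coord (x - y) k = coord x k - coord y k"
  by transfer simp

lemma coord_uminus [simp]: "coord (- x) k = - coord x k"
  by transfer simp

lemma coord_zero [simp]: "coord 0 k = 0"
  by transfer simp

lemma coord_scale [simp]: "coord (scale_m0 c x) k = c * coord x k"
  by transfer simp

lemma coord_e_vec:
  "coord (e_vec k :: 'a::field m0) j = (if j = k \<and> k \<in> {1..CHAR('a)} then 1 else 0)"
  by transfer simp

lemma coord_sum [simp]: "coord (sum f A) k = (\<Sum>i\<in>A. coord (f i) k)"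
  by (induction A rule: infinite_finite_induct) auto

lemma coord_outside: "k \<notin> {1..CHAR('a)} \<Longrightarrow> coord (x :: 'a::field m0) k = 0"
  using coord[of x] by auto

lemma e_vec_outside: "k \<notin> {1..CHAR('a)} \<Longrightarrow> (e_vec k :: 'a::field m0) = 0"
  by (rule m0_eqI) (auto simp: coord_e_vec)

lemma m0_expansion:
  "(x :: 'a::field m0) = (\<Sum>k=1..CHAR('a). scale_m0 (coord x k) (e_vec k))"
proof (rule m0_eqI)
  fix j
  have "(\<Sum>k=1..CHAR('a). coord x k * coord (e_vec k :: 'a m0) j)
      = (\<Sum>k=1..CHAR('a). if j = k then coord x k else 0)"
    by (rule sum.cong) (auto simp: coord_e_vec)
  then show "coord x j = coord (\<Sum>k=1..CHAR('a). scale_m0 (coord x k) (e_vec k)) j"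
    using coord_outside[of j x] by simp
qed

text \<open>Only \<open>[e_1, e_(k-1)]\<close> with \<open>k - 1 \<ge> 2\<close> contributes to
  \<open>e_k\<close>, hence the bound 3. Bracket identities thereby become coordinate
  algebra.\<close>

lemma coord_bracket:
  "coord (bracket x y :: 'a::field m0) k =
     (if 3 \<le> k \<and> k \<le> CHAR('a) then coord x 1 * coord y (k - 1) - coord y 1 * coord x (k - 1) else 0)"
proof -
  let ?p = "CHAR('a)"
  let ?P = "3 \<le> k \<and> k \<le> ?p"
  \<comment> \<open>Nested conditionals let each of the two sums collapse as a delta sum.\<close>
  have bb: "coord (basis_bracket i j :: 'a m0) k =
      (if i = 1 then (if j = k - 1 then (if ?P then 1 else 0) else 0) else 0)
      - (if j = 1 then (if i = k - 1 then (if ?P then 1 else 0) else 0) else 0)"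
    if "i \<in> {1..?p}" "j \<in> {1..?p}" for i j
    using that by (auto simp: basis_bracket_def coord_e_vec)
  have "coord (bracket x y) k =
      (\<Sum>i=1..?p. \<Sum>j=1..?p. coord x i * coord y j * coord (basis_bracket i j :: 'a m0) k)"
    by (simp add: bracket_def)
  also have "\<dots> = (\<Sum>i=1..?p. \<Sum>j=1..?p.
      (if i = 1 then (if j = k - 1 then (if ?P then coord x i * coord y j else 0) else 0) else 0)
      - (if j = 1 then (if i = k - 1 then (if ?P then coord x i * coord y j else 0) else 0) else 0))"
    by (intro sum.cong refl, subst bb) auto
  also have "\<dots> = (\<Sum>i=1..?p. if i = 1 then
        \<Sum>j=1..?p. (if j = k - 1 then (if ?P then coord x i * coord y j else 0) else 0) else 0)
      - (\<Sum>j=1..?p. if j = 1 then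
        \<Sum>i=1..?p. (if i = k - 1 then (if ?P then coord x i * coord y j else 0) else 0) else 0)"
    (is "_ = ?A - ?B")
  proof -
    have "(\<Sum>i=1..?p. \<Sum>j=1..?p. if i = 1 then
        (if j = k - 1 then (if ?P then coord x i * coord y j else 0) else 0) else 0) = ?A"
      by (rule sum.cong) simp_all
    moreover have "(\<Sum>i=1..?p. \<Sum>j=1..?p. if j = 1 then
        (if i = k - 1 then (if ?P then coord x i * coord y j else 0) else 0) else 0) = ?B"
      by (subst sum.swap, rule sum.cong) simp_all
    ultimately show ?thesis unfolding sum_subtractf by (simp only:)
  qed
  also have "\<dots> = (if ?P then coord x 1 * coord y (k - 1) - coord y 1 * coord x (k - 1) else 0)"
    by (auto simp: mult.commute)
  finally show ?thesis .
qed

lemma bracket_add_left: "bracket (x + y) z = bracket x z + bracket y z"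
  by (rule m0_eqI) (simp add: coord_bracket algebra_simps)

lemma bracket_add_right: "bracket x (y + z) = bracket x y + bracket x z"
  by (rule m0_eqI) (simp add: coord_bracket algebra_simps)

lemma bracket_scale_left: "bracket (scale_m0 c x) y = scale_m0 c (bracket x y)"
  by (rule m0_eqI) (simp add: coord_bracket algebra_simps)

lemma bracket_scale_right: "bracket x (scale_m0 c y) = scale_m0 c (bracket x y)"
  by (rule m0_eqI) (simp add: coord_bracket algebra_simps)

lemma bracket_self: "bracket x x = 0"
  by (rule m0_eqI) (simp add: coord_bracket)

text \<open>The Jacobi identity, with the terms arranged as \<open>d2\<close> produces them.\<close>

lemma bracket_jacobi:
  "bracket (bracket g h) f - bracket (bracket g f) h + bracket (bracket h f) g = 0"
  by (rule m0_eqI) (auto simp: coord_bracket algebra_simps)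

text \<open>For \<open>j \<ge> CHAR('a)\<close> both sides are \<open>0\<close>, because
  \<open>e_vec\<close> vanishes out of range; index shifts may therefore run past the top.\<close>

lemma bracket_e1:
  assumes "j \<ge> 2"
  shows "bracket (e_vec 1) (e_vec j :: 'a::field m0) = e_vec (Suc j)"
  by (rule m0_eqI) (use assms in \<open>auto simp: coord_bracket coord_e_vec\<close>)

lemma bracket_e_eq_0:
  assumes "i \<ge> 2" "j \<ge> 2"
  shows "bracket (e_vec i) (e_vec j :: 'a::field m0) = 0"
  by (rule m0_eqI) (use assms in \<open>auto simp: coord_bracket coord_e_vec\<close>)

lemma bracket_e_top: "bracket x (e_vec CHAR('a) :: 'a::field m0) = 0"
  by (rule m0_eqI) (auto simp: coord_bracket coord_e_vec)

text \<open>The lower central series: a left-normed bracket of \<open>n \<ge> 2\<close> vectors lies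
  in the span of \<open>e_(n+1), ..., e_p\<close>.\<close>

lemma coord_brackets_eq_0:
  assumes "length xs \<ge> 2" "k \<le> length xs"
  shows "coord (brackets xs) k = 0"
  using assms
proof (induction xs arbitrary: k rule: rev_induct)
  case (snoc x xs)
  show ?case
  proof (cases "length xs \<ge> 2")
    case True
    then have "brackets (xs @ [x]) = bracket (brackets xs) x"
      by (cases xs) (auto simp: brackets_def)
    \<comment> \<open>The inner bracket has first coordinate \<open>0\<close>, so coordinate
      \<open>k\<close> of the outer one involves only its coordinate \<open>k - 1\<close>.\<close>
    then show ?thesis
      using True snoc.prems snoc.IH[of 1] snoc.IH[of "k - 1"] by (simp add: coord_bracket)
  next
    case False
    then obtain y where "xs = [y]" using snoc.prems
      by (cases xs) (auto simp: not_le less_Suc_eq)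
    then show ?thesis using snoc.prems by (simp add: brackets_def coord_bracket)
  qed
qed simp

section \<open>Cochains\<close>

lemma linear_m0_iff:
  "Vector_Spaces.linear scale_m0 (*) (\<psi> :: 'a::field m0 \<Rightarrow> 'a) \<longleftrightarrow>
     (\<forall>x y. \<psi> (x + y) = \<psi> x + \<psi> y) \<and> (\<forall>c x. \<psi> (scale_m0 c x) = c * \<psi> x)"
proof -
  have "vector_space ((*) :: 'a \<Rightarrow> 'a \<Rightarrow> 'a)"
    by standard (simp_all add: algebra_simps)
  then show ?thesis
    using vector_space_m0[where 'a='a] by (simp add: Vector_Spaces.linear_iff)
qed

lemma C1_iff:
  "\<psi> \<in> C1 \<longleftrightarrow> (\<forall>x y. \<psi> (x + y) = \<psi> x + \<psi> y) \<and> (\<forall>c x. \<psi> (scale_m0 c x) = c * \<psi> x)"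
  by (simp add: C1_def linear_m0_iff)

lemma C1_zero: "\<psi> \<in> C1 \<Longrightarrow> \<psi> 0 = 0"
  unfolding C1_iff by (metis add_cancel_right_right)

lemma C2_iff:
  "\<phi> \<in> C2 \<longleftrightarrow> (\<forall>x y z. \<phi> x (y + z) = \<phi> x y + \<phi> x z) \<and> (\<forall>c x y. \<phi> x (scale_m0 c y) = c * \<phi> x y)
     \<and> (\<forall>x y z. \<phi> (x + y) z = \<phi> x z + \<phi> y z) \<and> (\<forall>c x y. \<phi> (scale_m0 c x) y = c * \<phi> x y)
     \<and> (\<forall>x. \<phi> x x = 0)"
  by (auto simp: C2_def linear_m0_iff)

lemma C2_antisym: "\<phi> \<in> C2 \<Longrightarrow> \<phi> x y = - \<phi> y x"
  unfolding C2_iff by (metis add.right_neutral add_0 add_eq_0_iff2)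

lemma C2_zero_right: "\<phi> \<in> C2 \<Longrightarrow> \<phi> x 0 = 0"
  unfolding C2_iff by (metis add_cancel_right_right)

lemma C2_zero_left: "\<phi> \<in> C2 \<Longrightarrow> \<phi> 0 x = 0"
  unfolding C2_iff by (metis add_cancel_right_right)

lemma C1_expansion:
  assumes "\<psi> \<in> C1"
  shows "\<psi> (x :: 'a::field m0) = (\<Sum>k=1..CHAR('a). coord x k * \<psi> (e_vec k))"
proof -
  have "\<psi> (sum f A) = (\<Sum>i\<in>A. \<psi> (f i))" for f and A :: "nat set"
    using assms C1_zero[OF assms]
    by (induction A rule: infinite_finite_induct) (auto simp: C1_iff)
  then show ?thesis
    using assms by (subst m0_expansion) (simp add: C1_iff)
qed

lemma C2_eqI:
  fixes \<phi> \<chi> :: "'a::field m0 \<Rightarrow> 'a m0 \<Rightarrow> 'a"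
  assumes "\<phi> \<in> C2" "\<chi> \<in> C2"
    and eq: "\<And>i j. \<lbrakk>1 \<le> i; i < j; j \<le> CHAR('a)\<rbrakk> \<Longrightarrow> \<phi> (e_vec i) (e_vec j) = \<chi> (e_vec i) (e_vec j)"
  shows "\<phi> = \<chi>"
proof (intro ext)
  fix x y
  have right: "\<xi> x y = (\<Sum>j=1..CHAR('a). coord y j * \<xi> x (e_vec j))"
    and left: "\<xi> x y = (\<Sum>i=1..CHAR('a). coord x i * \<xi> (e_vec i) y)" if "\<xi> \<in> C2"
    for x y and \<xi> :: "'a m0 \<Rightarrow> 'a m0 \<Rightarrow> 'a"
    using C1_expansion[of "\<xi> x" y] C1_expansion[of "\<lambda>x. \<xi> x y" x] that
    by (auto simp: C1_iff C2_iff)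
  have ij: "\<phi> (e_vec i) (e_vec j) = \<chi> (e_vec i) (e_vec j)" if "i \<in> {1..CHAR('a)}" "j \<in> {1..CHAR('a)}" for i j
  proof (cases i j rule: linorder_cases)
    case equal
    then show ?thesis using assms(1,2) by (simp add: C2_iff)
  next
    case greater
    then show ?thesis
      using eq[of j i] that C2_antisym[OF assms(1), of "e_vec i"] C2_antisym[OF assms(2), of "e_vec i"]
      by simp
  qed (use eq that in auto)
  have "\<phi> (e_vec i) y = \<chi> (e_vec i) y" if "i \<in> {1..CHAR('a)}" for i
    using ij that
    by (simp add: right[OF assms(1), of "e_vec i" y] right[OF assms(2), of "e_vec i" y])
  then show "\<phi> x y = \<chi> x y"
    by (simp add: left[OF assms(1), of x y] left[OF assms(2), of x y])
qed

section \<open>Frobenius-semilinear maps and the description of restricted cocycles\<close>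

definition p_semilinear :: "('a::field m0 \<Rightarrow> 'a) \<Rightarrow> bool" where
  "p_semilinear \<omega> \<longleftrightarrow> (\<forall>\<alpha> g. \<omega> (scale_m0 \<alpha> g) = \<alpha> ^ CHAR('a) * \<omega> g) \<and>
     (\<forall>g h. \<omega> (g + h) = \<omega> g + \<omega> h)"

lemma p_semilinear_expansion:
  assumes "p_semilinear \<omega>"
  shows "\<omega> (x :: 'a::field m0) = (\<Sum>k=1..CHAR('a). coord x k ^ CHAR('a) * \<omega> (e_vec k))"
proof -
  have "\<omega> 0 = 0" using assms unfolding p_semilinear_def by (metis add_cancel_right_right)
  then have "\<omega> (sum f A) = (\<Sum>i\<in>A. \<omega> (f i))" for f and A :: "nat set"
    using assms by (induction A rule: infinite_finite_induct) (auto simp: p_semilinear_def)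
  then show ?thesis
    using assms by (subst m0_expansion) (simp add: p_semilinear_def)
qed

lemma p_semilinear_eq_0:
  assumes "p_semilinear \<omega>" "\<And>k. k \<in> {1..CHAR('a)} \<Longrightarrow> \<omega> (e_vec k) = 0"
  shows "\<omega> = (\<lambda>_ :: 'a::field m0. 0)"
  by (rule ext, subst p_semilinear_expansion[OF assms(1)]) (simp add: assms(2))

text \<open>Additivity is the freshman's dream in prime characteristic. Both \<open>e_bar k\<close>
  and \<open>ind1 lam \<psi>\<close> have this shape.\<close>

lemma p_semilinear_frobenius_sum:
  assumes "prime CHAR('a::field)"
  shows "p_semilinear (\<lambda>x :: 'a m0. \<Sum>k\<in>A. coord x k ^ CHAR('a) * c k)"
  using assms
  by (simp add: p_semilinear_def freshmans_dream power_mult_distrib algebra_simps sum_distrib_left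
      sum.distrib)

lemma p_semilinear_e_bar:
  assumes "prime CHAR('a::field)"
  shows "p_semilinear (e_bar k :: 'a m0 \<Rightarrow> 'a)"
  using p_semilinear_frobenius_sum[OF assms, of "\<lambda>_. 1" "{k}"] by (simp add: e_bar_def[abs_def])

text \<open>A left-normed bracket of \<open>p - 1\<close> vectors is a multiple of \<open>e\<^sub>p\<close>, so the correction term
  vanishes on forms whose radical contains \<open>e\<^sub>p\<close>.\<close>

lemma star_correction_eq_0:
  fixes \<phi> :: "'a::field m0 \<Rightarrow> 'a m0 \<Rightarrow> 'a"
  assumes "\<phi> \<in> C2" and top: "\<And>g. \<phi> g (e_vec CHAR('a)) = 0" and "CHAR('a) \<ge> 3"
  shows "star_correction \<phi> g h = 0"
proof -
  let ?p = "CHAR('a)"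
  have "\<phi> (brackets xs) y = 0" if "length xs = ?p - 1" for xs y
  proof -
    have "brackets xs = scale_m0 (coord (brackets xs) ?p) (e_vec ?p)"
    proof (rule m0_eqI)
      fix k
      show "coord (brackets xs) k = coord (scale_m0 (coord (brackets xs) ?p) (e_vec ?p)) k"
        using coord_brackets_eq_0[of xs k] that assms(3) coord_outside[of k "brackets xs"]
        by (cases k ?p rule: linorder_cases) (auto simp: coord_e_vec)
    qed
    moreover have "\<phi> (e_vec ?p) y = 0" using C2_antisym[OF assms(1), of "e_vec ?p" y] top by simp
    ultimately show ?thesis using assms(1) unfolding C2_iff by (metis mult_zero_right)
  qed
  then show ?thesis
    by (auto simp: star_correction_def formal_sequences_def Let_def intro!: sum.neutral)
qed

lemma star_property_iff_p_semilinear: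
  fixes \<phi> :: "'a::field m0 \<Rightarrow> 'a m0 \<Rightarrow> 'a"
  assumes "\<phi> \<in> C2" "\<And>g. \<phi> g (e_vec CHAR('a)) = 0" "CHAR('a) \<ge> 3"
  shows "star_property \<phi> \<omega> \<longleftrightarrow> p_semilinear \<omega>"
  using star_correction_eq_0[OF assms] by (simp add: star_property_def p_semilinear_def)

text \<open>Without a correction term the candidates in \<open>THE\<close> are
  \<open>p\<close>-semilinear and vanish on the basis, so only the zero map remains.\<close>

lemma tilde_eq_0:
  fixes \<phi> :: "'a::field m0 \<Rightarrow> 'a m0 \<Rightarrow> 'a"
  assumes "\<phi> \<in> C2" "\<And>g. \<phi> g (e_vec CHAR('a)) = 0" "CHAR('a) \<ge> 3"
  shows "tilde \<phi> = (\<lambda>_. 0)"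
  unfolding tilde_def star_property_iff_p_semilinear[OF assms]
  using assms(3) by (intro the_equality) (auto intro: p_semilinear_eq_0 simp: p_semilinear_def)

lemma frobenius_sum_e_vec:
  assumes "k \<in> {1..CHAR('a::field)}"
  shows "(\<Sum>j=1..CHAR('a). coord (e_vec k :: 'a m0) j ^ CHAR('a) * c j) = c k"
proof -
  have "(\<Sum>j=1..CHAR('a). coord (e_vec k :: 'a m0) j ^ CHAR('a) * c j)
      = (\<Sum>j=1..CHAR('a). if j = k then c j else 0)"
    by (rule sum.cong) (use assms in \<open>auto simp: coord_e_vec power_0_left\<close>)
  then show ?thesis using assms by simp
qed

lemma Z2_star_iff:
  fixes lam :: "nat \<Rightarrow> 'a::field"
  assumes "CHAR('a) \<ge> 3" and "\<exists>k\<in>{1..CHAR('a)}. lam k \<noteq> 0"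
  shows "(\<phi>, \<omega>) \<in> Z2_star lam \<longleftrightarrow> \<phi> \<in> C2 \<and> (\<forall>g h f. d2 \<phi> g h f = 0) \<and>
    (\<forall>g. \<phi> g (e_vec CHAR('a)) = 0) \<and> p_semilinear \<omega>"
proof -
  let ?p = "CHAR('a)"
  have "(\<forall>g h. \<phi> g (p_map lam h) = 0) \<longleftrightarrow> (\<forall>g. \<phi> g (e_vec ?p) = 0)" if "\<phi> \<in> C2"
  proof
    obtain k where k: "k \<in> {1..?p}" "lam k \<noteq> 0" using assms(2) by blast
    \<comment> \<open>A single index with \<open>lam k \<noteq> 0\<close> suffices: the
      \<open>p\<close>-th power of \<open>e_k\<close> is then a nonzero multiple of
      \<open>e_p\<close>.\<close>
    have "p_map lam (e_vec k) = scale_m0 (lam k) (e_vec ?p)"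
      using k by (simp add: p_map_def frobenius_sum_e_vec del: One_nat_def)
    moreover assume "\<forall>g h. \<phi> g (p_map lam h) = 0"
    ultimately have "lam k * \<phi> g (e_vec ?p) = 0" for g
      using that unfolding C2_iff by metis
    then show "\<forall>g. \<phi> g (e_vec ?p) = 0" using k by simp
  qed (use that in \<open>auto simp: p_map_def C2_iff\<close>)
  then show ?thesis
    using star_property_iff_p_semilinear[of \<phi> \<omega>] assms(1)
    by (auto simp: Z2_star_def C2_star_def d2_star_def ind2_def fun_eq_iff)
qed

section \<open>Cocycles and coboundaries\<close>

lemma d1_in_C2:
  assumes "\<psi> \<in> C1"
  shows "d1 \<psi> \<in> C2"
  using assms C1_zero[OF assms]
  by (simp add: C2_iff C1_iff d1_def bracket_add_left bracket_add_right bracket_scale_left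
      bracket_scale_right bracket_self)

lemma d2_d1:
  assumes "\<psi> \<in> C1"
  shows "d2 (d1 \<psi>) g h f = 0"
proof -
  have "\<psi> (x - y) = \<psi> x - \<psi> y" for x y
    using assms unfolding C1_iff by (metis add_diff_cancel diff_add_cancel)
  then have "d2 (d1 \<psi>) g h f
      = \<psi> (bracket (bracket g h) f - bracket (bracket g f) h + bracket (bracket h f) g)"
    using assms by (simp add: d2_def d1_def C1_iff)
  then show ?thesis using C1_zero[OF assms] by (simp add: bracket_jacobi)
qed

text \<open>\<open>d1 \<psi>\<close> has \<open>e_p\<close> in its radical because
  \<open>e_p\<close> is central, and \<open>ind1 lam \<psi>\<close> is a Frobenius sum, so
  \<open>Z2_star_iff\<close> applies.\<close>

lemma B2_star_subset_Z2_star: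
  fixes lam :: "nat \<Rightarrow> 'a::field"
  assumes "prime CHAR('a)" "CHAR('a) \<ge> 3" and "\<exists>k\<in>{1..CHAR('a)}. lam k \<noteq> 0"
  shows "B2_star lam \<subseteq> Z2_star lam"
proof -
  have "d1_star lam \<psi> \<in> Z2_star lam" if "\<psi> \<in> C1" for \<psi>
  proof -
    have "p_semilinear (ind1 lam \<psi>)"
      using p_semilinear_frobenius_sum[OF assms(1), of "\<lambda>k. lam k * \<psi> (e_vec CHAR('a))"
          "{1..CHAR('a)}"] that
      by (simp add: ind1_def[abs_def] p_map_def C1_iff sum_distrib_right mult.assoc)
    then show ?thesis
      unfolding d1_star_def Z2_star_iff[OF assms(2,3)]
      using d1_in_C2[OF that] d2_d1[OF that] C1_zero[OF that] by (simp add: d1_def bracket_e_top)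
  qed
  then show ?thesis by (auto simp: B2_star_def)
qed

text \<open>The value \<open>\<phi> (e\<^sub>1, e\<^sub>p\<^sub>-\<^sub>1)\<close> determines \<open>\<psi> (e\<^sub>p)\<close> for a primitive \<open>\<psi>\<close> of \<open>\<phi>\<close>; subtracting
  \<open>ind1 \<psi>\<close> from \<open>\<omega>\<close> makes the first family of coordinates vanish on coboundaries.\<close>

definition omega_coord :: "(nat \<Rightarrow> 'a::field) \<Rightarrow> nat \<Rightarrow> 'a cochain2 \<Rightarrow> 'a" where
  "omega_coord lam k z = snd z (e_vec k) - lam k * fst z (e_vec 1) (e_vec (CHAR('a) - 1))"

text \<open>The index \<open>k\<close> is the weight \<open>2 + (k - 2)\<close>. On a closed form
  this one value governs all entries at \<open>i, j \<ge> 2\<close> with \<open>i + j = k\<close>,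
  by \<open>closed_form_shift\<close>.\<close>

definition phi_coord :: "nat \<Rightarrow> 'a::field cochain2 \<Rightarrow> 'a" where
  "phi_coord k z = fst z (e_vec 2) (e_vec (k - 2))"

text \<open>Both terms equal \<open>lam k * \<psi> (e_p)\<close>: the \<open>p\<close>-th power of
  \<open>e_k\<close> is \<open>lam k\<close> times \<open>e_p\<close>, and
  \<open>[e_1, e_(p-1)] = e_p\<close> as \<open>p - 1 \<ge> 2\<close>.\<close>

lemma omega_coord_d1_star:
  assumes "\<psi> \<in> C1" "CHAR('a::field) \<ge> 3" "k \<in> {1..CHAR('a)}"
  shows "omega_coord lam k (d1_star lam \<psi> :: 'a cochain2) = 0"
  using assms
  by (simp add: omega_coord_def d1_star_def d1_def ind1_def p_map_def frobenius_sum_e_vec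
      bracket_e1 C1_iff del: One_nat_def)

lemma phi_coord_d1_star:
  assumes "\<psi> \<in> C1" "k \<ge> 5"
  shows "phi_coord k (d1_star lam \<psi>) = 0"
  using assms by (simp add: phi_coord_def d1_star_def d1_def bracket_e_eq_0 C1_zero)

text \<open>Closedness at \<open>e_1, e_i, e_j\<close> moves one unit of index between the arguments
  at the cost of a sign; induction brings the first index down to 2.\<close>

lemma closed_form_shift:
  assumes "\<phi> \<in> C2" "\<And>g h f. d2 \<phi> g h f = 0" "i \<ge> 2" "j \<ge> 2"
  shows "\<phi> (e_vec i) (e_vec j) = (-1) ^ i * \<phi> (e_vec 2) (e_vec (i + j - 2))"
  using assms(3,4)
proof (induction i arbitrary: j rule: dec_induct)
  case (step i)
  have "\<phi> (e_vec (Suc i)) (e_vec j) - \<phi> (e_vec (Suc j)) (e_vec i) = 0"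
    using assms(2)[of "e_vec 1" "e_vec i" "e_vec j"] step C2_zero_left[OF assms(1)]
    by (simp add: d2_def bracket_e1 bracket_e_eq_0 del: One_nat_def)
  then have "\<phi> (e_vec (Suc i)) (e_vec j) = - \<phi> (e_vec i) (e_vec (Suc j))"
    using C2_antisym[OF assms(1), of "e_vec i" "e_vec (Suc j)"] by simp
  then show ?case using step.IH[of "Suc j"] step by simp
qed (simp add: power2_eq_square)

lemma closed_form_eq_0:
  fixes \<phi> :: "'a::field m0 \<Rightarrow> 'a m0 \<Rightarrow> 'a"
  assumes \<phi>: "\<phi> \<in> C2" "\<And>g h f. d2 \<phi> g h f = 0" and top: "\<And>g. \<phi> g (e_vec CHAR('a)) = 0"
    and p: "prime CHAR('a)" "CHAR('a) \<ge> 3"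
    and coords: "\<And>k. \<lbrakk>odd k; 5 \<le> k; k \<le> CHAR('a)\<rbrakk> \<Longrightarrow> \<phi> (e_vec 2) (e_vec (k - 2)) = 0"
    and ij: "i \<ge> 2" "j \<ge> 2"
  shows "\<phi> (e_vec i) (e_vec j) = 0"
proof -
  have "\<phi> (e_vec 2) (e_vec m) = 0" if m: "m \<ge> 2" for m
  proof (cases "even m")
    case True
    \<comment> \<open>For even \<open>m\<close>, shifting gives
      \<open>\<phi> (e_m, e_2) = \<phi> (e_2, e_m)\<close>, which antisymmetry turns into its own
      negative; the characteristic is not 2.\<close>
    then have "\<phi> (e_vec 2) (e_vec m) = - \<phi> (e_vec 2) (e_vec m)"
      using closed_form_shift[OF \<phi> m, of 2] C2_antisym[OF \<phi>(1), of "e_vec 2" "e_vec m"] by simp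
    then have "of_nat 2 * \<phi> (e_vec 2) (e_vec m) = 0"
      by (simp add: eq_neg_iff_add_eq_0)
    moreover have "of_nat 2 \<noteq> (0 :: 'a)"
      unfolding of_nat_eq_0_iff_char_dvd using p(2) dvd_imp_le[of "CHAR('a)" 2] by auto
    ultimately show ?thesis by simp
  next
    case False
    have "odd CHAR('a)" using p by (metis prime_odd_nat numeral_2_eq_2 numeral_3_eq_3 Suc_le_lessD)
    show ?thesis
    proof (cases m "CHAR('a)" rule: linorder_cases)
      case less
      \<comment> \<open>Two odd numbers \<open>m < p\<close> differ by at least 2, so
        \<open>m + 2\<close> is an admissible weight.\<close>
      then have "m + 2 \<le> CHAR('a)" using False \<open>odd CHAR('a)\<close> by presburger
      moreover have "m \<ge> 3" using m False by (cases "m = 2") auto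
      ultimately show ?thesis using coords[of "m + 2"] False by simp
    qed (use top C2_zero_right[OF \<phi>(1)] in \<open>auto simp: e_vec_outside\<close>)
  qed
  then show ?thesis using closed_form_shift[OF \<phi> ij] ij by simp
qed

text \<open>The common kernel of the coordinates is the space of coboundaries. For the harder
  inclusion an explicit primitive is constructed.\<close>

lemma B2_star_eq:
  fixes lam :: "nat \<Rightarrow> 'a::field"
  assumes p: "prime CHAR('a)" "CHAR('a) \<ge> 3" and lam: "\<exists>k\<in>{1..CHAR('a)}. lam k \<noteq> 0"
  shows "B2_star lam = {z \<in> Z2_star lam. (\<forall>k\<in>{1..CHAR('a)}. omega_coord lam k z = 0) \<and>
    (\<forall>k. odd k \<and> 5 \<le> k \<and> k \<le> CHAR('a) \<longrightarrow> phi_coord k z = 0)}"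
proof (intro equalityI subsetI)
  fix z assume "z \<in> B2_star lam"
  then show "z \<in> {z \<in> Z2_star lam. (\<forall>k\<in>{1..CHAR('a)}. omega_coord lam k z = 0) \<and>
      (\<forall>k. odd k \<and> 5 \<le> k \<and> k \<le> CHAR('a) \<longrightarrow> phi_coord k z = 0)}"
    using B2_star_subset_Z2_star[OF assms] omega_coord_d1_star[of _ _ lam] phi_coord_d1_star p(2)
    by (auto simp: B2_star_def)
next
  let ?p = "CHAR('a)"
  fix z assume z: "z \<in> {z \<in> Z2_star lam. (\<forall>k\<in>{1..?p}. omega_coord lam k z = 0) \<and>
      (\<forall>k. odd k \<and> 5 \<le> k \<and> k \<le> ?p \<longrightarrow> phi_coord k z = 0)}"
  obtain \<phi> \<omega> where z_eq: "z = (\<phi>, \<omega>)" by (cases z)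
  have \<phi>: "\<phi> \<in> C2" "\<And>g h f. d2 \<phi> g h f = 0" "\<And>g. \<phi> g (e_vec ?p) = 0" and \<omega>: "p_semilinear \<omega>"
    using z Z2_star_iff[OF p(2) lam] by (auto simp: z_eq)
  have \<omega>_e: "\<omega> (e_vec k) = lam k * \<phi> (e_vec 1) (e_vec (?p - 1))" if "k \<in> {1..?p}" for k
    using z that by (auto simp: z_eq omega_coord_def)
  have zero: "\<phi> (e_vec i) (e_vec j) = 0" if "i \<ge> 2" "j \<ge> 2" for i j
    by (rule closed_form_eq_0[OF \<phi> p _ that]) (use z in \<open>auto simp: z_eq phi_coord_def\<close>)
  \<comment> \<open>Forced on the derived algebra by
    \<open>\<psi> [e_1, e_(k-1)] = \<phi> (e_1, e_(k-1))\<close>; on \<open>e_1\<close> and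
    \<open>e_2\<close> the value \<open>0\<close> is a choice.\<close>
  define \<psi> :: "'a m0 \<Rightarrow> 'a" where
    "\<psi> x = (\<Sum>k=3..?p. coord x k * \<phi> (e_vec 1) (e_vec (k - 1)))" for x
  have \<psi>: "\<psi> \<in> C1"
    by (simp add: C1_iff \<psi>_def algebra_simps sum.distrib sum_distrib_left)
  have \<psi>_e: "\<psi> (e_vec k) = (if 3 \<le> k \<and> k \<le> ?p then \<phi> (e_vec 1) (e_vec (k - 1)) else 0)" for k
  proof -
    have "\<psi> (e_vec k) = (\<Sum>i=3..?p. if i = k then \<phi> (e_vec 1) (e_vec (k - 1)) else 0)"
      unfolding \<psi>_def by (rule sum.cong) (auto simp: coord_e_vec)
    then show ?thesis by simp
  qed
  have "\<phi> = d1 \<psi>"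
  proof (rule C2_eqI[OF \<phi>(1) d1_in_C2[OF \<psi>]])
    fix i j assume ij: "1 \<le> i" "i < j" "j \<le> ?p"
    show "\<phi> (e_vec i) (e_vec j) = d1 \<psi> (e_vec i) (e_vec j)"
    proof (cases "i = 1")
      case True
      \<comment> \<open>At \<open>j = p\<close> the left side vanishes since \<open>e_p\<close> is
        in the radical, the right side since \<open>e_(p+1) = 0\<close>.\<close>
      then show ?thesis using ij \<phi>(3) by (cases "j = ?p") (auto simp: d1_def bracket_e1 \<psi>_e simp del: One_nat_def)
    next
      case False
      then show ?thesis using ij zero C1_zero[OF \<psi>] by (simp add: d1_def bracket_e_eq_0)
    qed
  qed
  moreover have "\<omega> = ind1 lam \<psi>"
  proof
    fix x
    have "\<omega> x = (\<Sum>k=1..?p. coord x k ^ ?p * (lam k * \<phi> (e_vec 1) (e_vec (?p - 1))))"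
      by (subst p_semilinear_expansion[OF \<omega>]) (simp add: \<omega>_e)
    also have "\<dots> = ind1 lam \<psi> x"
      using \<psi> p(2) by (simp add: ind1_def p_map_def C1_iff \<psi>_e sum_distrib_right mult.assoc)
    finally show "\<omega> x = ind1 lam \<psi> x" .
  qed
  ultimately show "z \<in> B2_star lam" using \<psi> by (auto simp: z_eq B2_star_def d1_star_def)
qed

section \<open>The cocycles \<open>\<phi>\<^sub>k\<close>\<close>

text \<open>For odd \<open>k\<close> the reflection \<open>i \<mapsto> k - i\<close> reverses the
  sign, so the antisymmetrised half sum unfolds to the whole antidiagonal. This form shows
  bilinearity, the original one alternation.\<close>

lemma phi_eq_sum:
  assumes "odd k" "k \<ge> 5"
  shows "phi k x y = (\<Sum>i=2..k-2. (-1) ^ i * coord x i * coord y (k - i))"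
proof -
  have "(\<Sum>i=2..k div 2. (-1) ^ i * (coord x (k - i) * coord y i))
      = (\<Sum>i=k div 2 + 1..k-2. - ((-1) ^ i * coord x i * coord y (k - i)))"
    by (rule sum.reindex_bij_witness[of _ "\<lambda>i. k - i" "\<lambda>i. k - i"])
      (use assms(1) in \<open>auto simp: minus_one_power_iff elim!: oddE\<close>)
  moreover have "(\<Sum>i=2..k-2. (-1) ^ i * coord x i * coord y (k - i))
     = (\<Sum>i=2..k div 2. (-1) ^ i * coord x i * coord y (k - i))
      + (\<Sum>i=k div 2 + 1..k-2. (-1) ^ i * coord x i * coord y (k - i))"
    using assms by (subst sum.union_disjoint [symmetric]) (auto intro!: sum.cong)
  ultimately show ?thesis
    by (simp add: phi_def e_dual2_def algebra_simps sum_subtractf sum_negf)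
qed

lemma phi_in_C2:
  assumes "odd k" "k \<ge> 5"
  shows "phi k \<in> (C2 :: ('a::field m0 \<Rightarrow> 'a m0 \<Rightarrow> 'a) set)"
proof -
  have "phi k x x = 0" for x :: "'a m0" by (simp add: phi_def e_dual2_def mult.commute)
  then show ?thesis
    by (simp add: C2_iff phi_eq_sum[OF assms] algebra_simps sum.distrib sum_distrib_left)
qed

text \<open>\<open>phi k (bracket u v) w\<close> is expressed through a symmetric form
  \<open>S\<close>, and the three terms of \<open>d2\<close> then cancel in pairs.\<close>

lemma d2_phi:
  assumes k: "odd k" "k \<ge> 5" "k \<le> CHAR('a::field)"
  shows "d2 (phi k) g h (f :: 'a m0) = 0"
proof -
  define S where "S u v = (\<Sum>i=3..k-2. (-1) ^ i * (coord u (i - 1) * coord v (k - i)))"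
    for u v :: "'a m0"
  \<comment> \<open>The reflection \<open>i \<mapsto> k + 1 - i\<close> preserves both the range
    \<open>3..k-2\<close> and, as \<open>k + 1\<close> is even, the sign.\<close>
  have S_sym: "S u v = S v u" for u v
    unfolding S_def
    by (rule sum.reindex_bij_witness[of _ "\<lambda>i. k + 1 - i" "\<lambda>i. k + 1 - i"])
      (use k in \<open>auto simp: minus_one_power_iff Suc_diff_le\<close>)
  have phi_bracket: "phi k (bracket u v) w = coord u 1 * S v w - coord v 1 * S u w" for u v w :: "'a m0"
  proof -
    have "phi k (bracket u v) w = (\<Sum>i=2..k-2. (-1) ^ i * coord (bracket u v) i * coord w (k - i))"
      using phi_eq_sum k by blast
    \<comment> \<open>Brackets have no \<open>e_2\<close> component.\<close>
    also have "\<dots> = (\<Sum>i=3..k-2. (-1) ^ i * coord (bracket u v) i * coord w (k - i))"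
      by (rule sum.mono_neutral_right) (auto simp: coord_bracket)
    also have "\<dots> = (\<Sum>i=3..k-2. coord u 1 * ((-1) ^ i * (coord v (i - 1) * coord w (k - i)))
        - coord v 1 * ((-1) ^ i * (coord u (i - 1) * coord w (k - i))))"
      by (rule sum.cong) (use k in \<open>auto simp: coord_bracket algebra_simps\<close>)
    finally show ?thesis by (simp add: S_def sum_subtractf sum_distrib_left)
  qed
  show ?thesis
    unfolding d2_def phi_bracket
    using S_sym[of g h] S_sym[of g f] S_sym[of h f] by (simp add: algebra_simps)
qed

lemma phi_e_vec:
  assumes k: "odd k" "k \<ge> 5" "k \<le> CHAR('a::field)"
    and ij: "i \<le> CHAR('a)" "j \<le> CHAR('a)"
  shows "phi k (e_vec i) (e_vec j :: 'a m0) = (if 2 \<le> i \<and> 2 \<le> j \<and> i + j = k then (-1) ^ i else 0)"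
proof -
  have "phi k (e_vec i) (e_vec j :: 'a m0)
      = (\<Sum>l=2..k-2. if l = i then (if 2 \<le> j \<and> i + j = k then (-1) ^ i else 0) else 0)"
    unfolding phi_eq_sum[OF k(1,2)] by (rule sum.cong) (use assms in \<open>auto simp: coord_e_vec\<close>)
  then show ?thesis by auto
qed

text \<open>The second index \<open>k - i\<close> is at most \<open>k - 2\<close>, hence below
  \<open>p\<close>.\<close>

lemma phi_e_top:
  assumes k: "odd k" "k \<ge> 5" "k \<le> CHAR('a::field)"
  shows "phi k g (e_vec CHAR('a) :: 'a m0) = 0"
  unfolding phi_eq_sum[OF k(1,2)] by (rule sum.neutral) (use k in \<open>auto simp: coord_e_vec\<close>)

section \<open>The module of cocycles and the assembly of the basis\<close>

lemma module_Z2_star: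
  fixes lam :: "nat \<Rightarrow> 'a::field"
  assumes p: "CHAR('a) \<ge> 3" and lam: "\<exists>k\<in>{1..CHAR('a)}. lam k \<noteq> 0"
  shows "Module.module class_ring (C2_star\<lparr>carrier := Z2_star lam\<rparr>)"
proof (rule moduleI)
  note Z = Z2_star_iff[OF assms]
  \<comment> \<open>Besides closure under scalars, the case \<open>c = -1\<close> supplies additive
    inverses.\<close>
  have smult: "(\<lambda>x y. c * \<phi> x y, \<lambda>x. c * \<omega> x) \<in> Z2_star lam" if "(\<phi>, \<omega>) \<in> Z2_star lam" for c \<phi> \<omega>
  proof -
    have "d2 (\<lambda>x y. c * \<phi> x y) g h f = c * d2 \<phi> g h f" for g h f
      by (simp add: d2_def algebra_simps)
    then show ?thesis using that unfolding Z by (simp add: C2_iff p_semilinear_def algebra_simps)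
  qed
  show "abelian_group (C2_star\<lparr>carrier := Z2_star lam\<rparr>)"
  proof (rule abelian_groupI)
    fix z assume z: "z \<in> carrier (C2_star\<lparr>carrier := Z2_star lam\<rparr>)"
    then show "\<exists>z'\<in>carrier (C2_star\<lparr>carrier := Z2_star lam\<rparr>).
        z' \<oplus>\<^bsub>C2_star\<lparr>carrier := Z2_star lam\<rparr>\<^esub> z = \<zero>\<^bsub>C2_star\<lparr>carrier := Z2_star lam\<rparr>\<^esub>"
      using smult[of "fst z" "snd z" "-1"]
      by (intro bexI[of _ "(\<lambda>x y. - 1 * fst z x y, \<lambda>x. - 1 * snd z x)"])
        (auto simp: C2_star_def split_beta)
  next
    fix z z' assume "z \<in> carrier (C2_star\<lparr>carrier := Z2_star lam\<rparr>)"
      "z' \<in> carrier (C2_star\<lparr>carrier := Z2_star lam\<rparr>)"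
    moreover obtain \<phi> \<omega> \<phi>' \<omega>' where "z = (\<phi>, \<omega>)" "z' = (\<phi>', \<omega>')" by (cases z, cases z')
    moreover have "d2 (\<lambda>x y. \<phi> x y + \<phi>' x y) g h f = d2 \<phi> g h f + d2 \<phi>' g h f" for g h f
      by (simp add: d2_def)
    ultimately show "z \<oplus>\<^bsub>C2_star\<lparr>carrier := Z2_star lam\<rparr>\<^esub> z' \<in> carrier (C2_star\<lparr>carrier := Z2_star lam\<rparr>)"
      by (simp add: C2_star_def Z) (simp add: C2_iff p_semilinear_def algebra_simps)
  qed (auto simp: C2_star_def Z C2_iff d2_def p_semilinear_def add_ac split_beta)
  show "c \<odot>\<^bsub>C2_star\<lparr>carrier := Z2_star lam\<rparr>\<^esub> z \<in> carrier (C2_star\<lparr>carrier := Z2_star lam\<rparr>)"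
    if "z \<in> carrier (C2_star\<lparr>carrier := Z2_star lam\<rparr>)" for c z
    using that smult by (cases z) (auto simp: C2_star_def)
qed (use class_cring.is_cring in \<open>auto simp: C2_star_def split_beta algebra_simps\<close>)

lemma card_odd_ge_5_le:
  assumes "odd p"
  shows "card {k. odd k \<and> 5 \<le> k \<and> k \<le> p} = (p - 3) div 2"
proof -
  have "bij_betw (\<lambda>i. 2 * i + 3) {1..(p - 3) div 2} {k. odd k \<and> 5 \<le> k \<and> k \<le> p}"
    by (rule bij_betwI[of _ _ _ "\<lambda>k. (k - 3) div 2"]) (use assms in \<open>auto elim!: oddE\<close>)
  then show ?thesis using bij_betw_same_card by fastforce
qed

theorem theorem4p5:
  fixes p :: nat and lam :: "nat \<Rightarrow> 'a::field"
  assumes "prime p" and "p \<ge> 3" and "CHAR('a) = p"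
    and "\<exists>k\<in>{1..p}. lam k \<noteq> 0"
  shows "vectorspace class_ring (H2_star lam)
    \<and> real (vectorspace.dim class_ring (H2_star lam)) = (3 * real p - 3) / 2
    \<and> vectorspace.basis class_ring (H2_star lam)
        (cohomology_class lam `
          ({(\<lambda>_ _. 0, e_bar k) | k. 1 \<le> k \<and> k \<le> p} \<union>
           {(phi k, tilde (phi k)) | k. odd k \<and> 5 \<le> k \<and> k \<le> p}))
    \<and> (p = 3 \<longrightarrow>
         vectorspace.basis class_ring (H2_star lam)
           (cohomology_class lam `
             {(\<lambda>_ _. 0, e_bar 1), (\<lambda>_ _. 0, e_bar 2), (\<lambda>_ _. 0, e_bar 3)}))"
proof -
  have p: "prime CHAR('a)" "CHAR('a) \<ge> 3" and lam: "\<exists>k\<in>{1..CHAR('a)}. lam k \<noteq> 0"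
    using assms by auto
  have p_eq: "p = CHAR('a)" using assms by simp
  define Odd where "Odd = {k. odd k \<and> 5 \<le> k \<and> k \<le> CHAR('a)}"
  \<comment> \<open>A tagged union, because an odd \<open>k \<ge> 5\<close> indexes a coordinate in
    both families.\<close>
  define I where "I = {1..CHAR('a)} <+> Odd"
  define M where "M = C2_star\<lparr>carrier := Z2_star lam\<rparr>"
  define f where "f = case_sum (omega_coord lam) (phi_coord :: nat \<Rightarrow> 'a cochain2 \<Rightarrow> 'a)"
  define b :: "nat + nat \<Rightarrow> 'a cochain2" where
    "b = case_sum (\<lambda>k. (\<lambda>_ _. 0, e_bar k)) (\<lambda>k. (phi k, tilde (phi k)))"
  have finite_Odd: "finite Odd" unfolding Odd_def by (rule finite_subset[of _ "{..CHAR('a)}"]) auto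
  have tilde: "tilde (phi k :: 'a m0 \<Rightarrow> 'a m0 \<Rightarrow> 'a) = (\<lambda>_. 0)" if "k \<in> Odd" for k
    using that p by (intro tilde_eq_0) (auto simp: Odd_def phi_in_C2 phi_e_top)
  have e_bar_e: "e_bar k (e_vec j :: 'a m0) = (if j = k then 1 else 0)" if "k \<in> {1..CHAR('a)}" for j k
    using that by (auto simp: e_bar_def coord_e_vec power_0_left)
  interpret dual_family M I f b
  proof (intro dual_family.intro dual_family_axioms.intro)
    show "Module.module class_ring M" unfolding M_def by (rule module_Z2_star[OF p(2) lam])
    show "finite I" using finite_Odd by (simp add: I_def)
  next
    fix i x y assume "i \<in> I" "x \<in> carrier M" "y \<in> carrier M"
    then show "f i (x \<oplus>\<^bsub>M\<^esub> y) = f i x + f i y"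
      by (auto simp: f_def M_def C2_star_def omega_coord_def phi_coord_def split_beta algebra_simps
          split: sum.splits)
  next
    fix i x c assume "i \<in> I" "x \<in> carrier M"
    then show "f i (c \<odot>\<^bsub>M\<^esub> x) = c * f i x"
      by (auto simp: f_def M_def C2_star_def omega_coord_def phi_coord_def split_beta algebra_simps
          split: sum.splits)
  next
    fix i assume "i \<in> I"
    then show "b i \<in> carrier M"
    proof (cases i)
      case (Inl k)
      then show ?thesis
        using p_semilinear_e_bar[OF p(1), of k]
        by (simp add: b_def M_def Z2_star_iff[OF p(2) lam] C2_iff d2_def)
    next
      case (Inr k)
      then have "k \<in> Odd" using \<open>i \<in> I\<close> by (auto simp: I_def)
      then show ?thesis
        using Inr
        by (simp add: b_def M_def Z2_star_iff[OF p(2) lam] tilde)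
          (simp add: phi_in_C2 d2_phi phi_e_top Odd_def p_semilinear_def)
    qed
  next
    fix i j assume "i \<in> I" "j \<in> I"
    then consider (LL) k l where "i = Inl k" "j = Inl l" "k \<in> {1..CHAR('a)}" "l \<in> {1..CHAR('a)}"
      | (LR) k l where "i = Inl k" "j = Inr l" "k \<in> {1..CHAR('a)}" "l \<in> Odd"
      | (RL) k l where "i = Inr k" "j = Inl l" "k \<in> Odd" "l \<in> {1..CHAR('a)}"
      | (RR) k l where "i = Inr k" "j = Inr l" "k \<in> Odd" "l \<in> Odd"
      unfolding I_def by blast
    then show "f i (b j) = (if i = j then 1 else 0)"
    proof cases
      case LL
      then show ?thesis by (simp add: f_def b_def omega_coord_def e_bar_e)
    next
      case LR
      \<comment> \<open>\<open>phi l\<close> vanishes at \<open>(e_1, e_(p-1))\<close>, since its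
        indices start at 2.\<close>
      then show ?thesis
        using phi_e_vec[of l 1 "CHAR('a) - 1", where 'a='a] p(2)
        by (simp add: f_def b_def omega_coord_def tilde) (simp add: Odd_def)
    next
      case RL
      then show ?thesis by (simp add: f_def b_def phi_coord_def)
    next
      case RR
      then show ?thesis
        using phi_e_vec[of l 2 "k - 2", where 'a='a] p(2)
        by (auto simp: f_def b_def phi_coord_def Odd_def)
    qed
  qed
  have B2: "fibre (\<lambda>_. 0) = B2_star lam"
    unfolding B2_star_eq[OF p lam] fibre_def
    by (auto simp: M_def I_def f_def Odd_def Plus_def ball_Un)
  have H2: "Quot = H2_star lam" unfolding H2_star_def B2 M_def[symmetric] ..
  \<comment> \<open>\<open>M\<close> and \<open>C2_star\<close> differ only in the carrier, so they
    form the same cosets.\<close>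
  have coset: "fibre (\<lambda>_. 0) +>\<^bsub>M\<^esub> z = cohomology_class lam z" for z
    unfolding B2 cohomology_class_def a_r_coset_def' by (simp add: M_def)
  have b_I: "b ` I = {(\<lambda>_ _. 0, e_bar k) | k. 1 \<le> k \<and> k \<le> p} \<union>
      {(phi k, tilde (phi k)) | k. odd k \<and> 5 \<le> k \<and> k \<le> p}"
    unfolding I_def Plus_def image_Un image_image by (auto simp: b_def Odd_def p_eq)
  have "odd p" using assms(1,2) prime_odd_nat[of p] by auto
  then have "card I = p + (p - 3) div 2"
    using finite_Odd card_odd_ge_5_le[of p] by (simp add: I_def card_Plus Odd_def p_eq)
  \<comment> \<open>The division is exact for odd \<open>p\<close>, which permits passing to the
    reals.\<close>
  moreover have "p = 2 * ((p - 3) div 2) + 3"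
    using \<open>odd p\<close> assms(2) by presburger
  then obtain m where "p = 2 * m + 3" by blast
  ultimately have dim: "real (vectorspace.dim class_ring (H2_star lam)) = (3 * real p - 3) / 2"
    using dim_quot unfolding H2 by simp
  have basis: "vectorspace.basis class_ring (H2_star lam) (cohomology_class lam ` b ` I)"
    using basis_quot unfolding H2 coset image_image .
  have basis_3: "vectorspace.basis class_ring (H2_star lam)
      (cohomology_class lam ` {(\<lambda>_ _. 0, e_bar 1), (\<lambda>_ _. 0, e_bar 2), (\<lambda>_ _. 0, e_bar 3)})"
    if "p = 3"
  proof -
    have "{1..CHAR('a)} = {1, 2, 3}" "Odd = {}"
      using that p_eq by (auto simp: Odd_def)
    then have "b ` I = {(\<lambda>_ _. 0, e_bar 1), (\<lambda>_ _. 0, e_bar 2), (\<lambda>_ _. 0, e_bar 3)}"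
      unfolding I_def Plus_def by (simp add: b_def)
    then show ?thesis using basis by (simp only:)
  qed
  show ?thesis
    using vectorspace_quot[unfolded H2] dim basis[unfolded b_I] basis_3 by blast
qed

end
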